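(* Let $d\geq 1$ and let $\varphi(z)=\sum_{j=1}^d c_j z_j$ with $c_1,\ldots,c_d\in\mathbb{C}$ not all zero. If the nonzero coefficients among $c_1,\ldots,c_d$ all have the same modulus, then $\varphi$ is a Hilbert point in $H^p(\mathbb{T}^d)$ for every $1\leq p\leq \infty$.
   Context: $\mathbb{T}^d$ is the $d$-dimensional torus with normalized Haar measure $m_d$; $\widehat f(\alpha)=\int_{\mathbb{T}^d} f(z)\overline{z^\alpha}\,dm_d(z)$ for $\alpha\in\mathbb{Z}^d$. The Hardy space $H^p(\mathbb{T}^d)$ is the closed subspace of $L^p(\mathbb{T}^d)$ of functions $f$ with $\widehat f(\alpha)=0$ for all $\alpha\in\mathbb{Z}^d\setminus\mathbb{N}_0^d$, $\mathbb{N}_0=\{0,1,2,\ldots\}$, with the $L^p$ norm $\|\cdot\|_{H^p(\mathbb{T}^d)}$. Write $\langle f,g\rangle=\int_{\mathbb{T}^d} f\overline g\,dm_d$. A nontrivial (i.e. not a.e. zero) function $\varphi$ in $H^p(\mathbb{T}^d)$, $1\le p\le\infty$, is a Hilbert point in $H^p(\mathbb{T}^d)$ if $\|\varphi\|_{H^p(\mathbb{T}^d)}\le\|\varphi+f\|_{H^p(\mathbb{T}^d)}$ for every $f\in H^p(\mathbb{T}^d)$ such that $\langle f,\varphi\rangle=0$. When $1\le p<2$, the condition $\langle f,\varphi\rangle=0$ is declared to mean that $f$ lies in the closure in $H^p(\mathbb{T}^d)$ of the set of analytic polynomials $g$ with $\langle g,\varphi\rangle=0$. *)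

theory Defs
  imports "HOL-Probability.Probability"
begin

(* Elements of L^p are represented by functions rather than by classes modulo null sets. *)

definition Lp_space :: "'a measure \<Rightarrow> ennreal \<Rightarrow> ('a \<Rightarrow> complex) set" where
  "Lp_space M p = {f \<in> borel_measurable M.
     if p = \<infinity> then esssup M (\<lambda>x. ennreal (norm (f x))) < \<infinity>
     else integrable M (\<lambda>x. norm (f x) powr enn2real p)}"

(* Meaningful only on Lp_space M p: outside it, the junk values of the integral and of
   enn2real apply. *)
definition Lp_norm :: "'a measure \<Rightarrow> ennreal \<Rightarrow> ('a \<Rightarrow> complex) \<Rightarrow> real" where
  "Lp_norm M p f =
     (if p = \<infinity> then enn2real (esssup M (\<lambda>x. ennreal (norm (f x))))
      else (LINT x|M. norm (f x) powr enn2real p) powr (1 / enn2real p))"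

(* Normalized Haar measure of the unit circle, as the image of normalized Lebesgue measure
   on [0, 2 pi) under t \<mapsto> exp (i t). *)
definition circle_measure :: "complex measure" where
  "circle_measure =
     distr (uniform_measure lborel {0..<2 * pi}) (restrict_space borel (sphere 0 1)) cis"

(* Its space is {1..d} \<rightarrow>\<^sub>E sphere 0 1, the d-dimensional torus. *)
definition torus_measure :: "nat \<Rightarrow> (nat \<Rightarrow> complex) measure" where
  "torus_measure d = Pi\<^sub>M {1..d} (\<lambda>_. circle_measure)"

definition torus_monomial :: "nat \<Rightarrow> (nat \<Rightarrow> int) \<Rightarrow> (nat \<Rightarrow> complex) \<Rightarrow> complex" where
  "torus_monomial d \<alpha> z = (\<Prod>j=1..d. z j powi \<alpha> j)"

definition torus_inner ::
  "nat \<Rightarrow> ((nat \<Rightarrow> complex) \<Rightarrow> complex) \<Rightarrow> ((nat \<Rightarrow> complex) \<Rightarrow> complex) \<Rightarrow> complex" where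
  "torus_inner d f g = (LINT z|torus_measure d. f z * cnj (g z))"

definition fourier_coeff ::
  "nat \<Rightarrow> ((nat \<Rightarrow> complex) \<Rightarrow> complex) \<Rightarrow> (nat \<Rightarrow> int) \<Rightarrow> complex" where
  "fourier_coeff d f \<alpha> = (LINT z|torus_measure d. f z * cnj (torus_monomial d \<alpha> z))"

definition multi_indices :: "nat \<Rightarrow> (nat \<Rightarrow> int) set" where
  "multi_indices d = {1..d} \<rightarrow>\<^sub>E UNIV"

definition nonneg_multi_indices :: "nat \<Rightarrow> (nat \<Rightarrow> int) set" where
  "nonneg_multi_indices d = {1..d} \<rightarrow>\<^sub>E {0..}"

definition hardy_space :: "nat \<Rightarrow> ennreal \<Rightarrow> ((nat \<Rightarrow> complex) \<Rightarrow> complex) set" where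
  "hardy_space d p = {f \<in> Lp_space (torus_measure d) p.
     \<forall>\<alpha> \<in> multi_indices d - nonneg_multi_indices d. fourier_coeff d f \<alpha> = 0}"

abbreviation hardy_norm :: "nat \<Rightarrow> ennreal \<Rightarrow> ((nat \<Rightarrow> complex) \<Rightarrow> complex) \<Rightarrow> real" where
  "hardy_norm d p \<equiv> Lp_norm (torus_measure d) p"

definition analytic_polynomials :: "nat \<Rightarrow> ((nat \<Rightarrow> complex) \<Rightarrow> complex) set" where
  "analytic_polynomials d =
     {(\<lambda>z. \<Sum>\<alpha>\<in>A. a \<alpha> * torus_monomial d \<alpha> z) | A a.
        finite A \<and> A \<subseteq> nonneg_multi_indices d}"

(* For p < 2 the product of f and cnj \<phi> need not be integrable, so orthogonality is defined
   there as membership in the H^p-closure of the analytic polynomials orthogonal to \<phi>. *)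
definition hardy_orthogonal ::
  "nat \<Rightarrow> ennreal \<Rightarrow> ((nat \<Rightarrow> complex) \<Rightarrow> complex) \<Rightarrow> ((nat \<Rightarrow> complex) \<Rightarrow> complex) \<Rightarrow> bool" where
  "hardy_orthogonal d p f \<phi> \<longleftrightarrow>
     (if p < 2 then
        f \<in> hardy_space d p \<and>
        (\<forall>\<epsilon>>0. \<exists>g \<in> analytic_polynomials d.
           torus_inner d g \<phi> = 0 \<and> hardy_norm d p (\<lambda>z. f z - g z) < \<epsilon>)
      else torus_inner d f \<phi> = 0)"

definition hilbert_point :: "nat \<Rightarrow> ennreal \<Rightarrow> ((nat \<Rightarrow> complex) \<Rightarrow> complex) \<Rightarrow> bool" where
  "hilbert_point d p \<phi> \<longleftrightarrow>
     \<phi> \<in> hardy_space d p \<and>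
     \<not> (AE z in torus_measure d. \<phi> z = 0) \<and>
     (\<forall>f \<in> hardy_space d p. hardy_orthogonal d p f \<phi> \<longrightarrow>
        hardy_norm d p \<phi> \<le> hardy_norm d p (\<lambda>z. \<phi> z + f z))"

end

(* Write phi = c_1 z_1 + ... + c_d z_d. For finite p, minimality of phi follows from the convexity
   of |w|^p as soon as every f in H^p with <f, phi> = 0 is also orthogonal to phi |phi|^(p-2).
   Since phi is bounded, it suffices to consider f in H^1, and polynomial approximation reduces the
   claim to phi |phi|^(2k) = phi^(k+1) cnj(phi)^k. The latter is a trigonometric polynomial, all of
   whose frequencies have coordinate sum 1; f only sees the nonnegative ones, which are those of
   z_1, ..., z_d. Equality of the moduli makes the coefficient of z_j a constant multiple of c_j, so
   that the pairing with f is a multiple of <f, phi> = 0. *)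

theory Submission
  imports Defs
begin

text \<open>Even powers come first because phi |phi|^(2k) expands into finitely many monomials.
  Expanding over words, not with multinomial coefficients, makes the constant visible: a pair of
  words has a nonnegative frequency only if the longer word is a rearrangement of the shorter one
  plus one letter m. The coefficient is then c_m rho^(2k), with rho the common modulus, and
  exchanging two letters shows that the number of such pairs is the same for every m. The weights
  needed in the end are in general not polynomials in |phi|^2. Weierstrass approximation reaches all
  continuous functions of |phi|^2, but for p < 2 the weight |phi|^(p-2) blows up at the zeros of
  phi. It is shifted off the singularity first, and the factor phi keeps the passage to the limit
  dominated. For p = infinity there is no power to differentiate; a continuous cut-off weight takes
  its place.\<close>

section \<open>Fourier analysis on the torus\<close>

lemma sets_circle_measure: "sets circle_measure = sets (restrict_space borel (sphere 0 1))"
  by (simp add: circle_measure_def)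

lemma space_circle_measure: "space circle_measure = sphere 0 1"
  by (simp add: circle_measure_def space_restrict_space)

lemma measurable_cis_sphere: "cis \<in> borel \<rightarrow>\<^sub>M restrict_space borel (sphere 0 1)"
  by (intro measurable_restrict_space2 borel_measurable_continuous_onI continuous_intros) auto

lemma prob_space_circle_measure: "prob_space circle_measure"
  unfolding circle_measure_def
proof (rule prob_space.prob_space_distr)
  show "prob_space (uniform_measure lborel {0..<2 * pi})"
    by (rule prob_space_uniform_measure) auto
  show "cis \<in> uniform_measure lborel {0..<2 * pi} \<rightarrow>\<^sub>M restrict_space borel (sphere 0 1)"
    using measurable_cis_sphere by simp
qed

lemma borel_measurable_power_int_complex [measurable]:
  "(\<lambda>z::complex. z powi n) \<in> borel_measurable borel"
  unfolding power_int_def by measurable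

lemma borel_measurable_cnj [measurable]: "cnj \<in> borel_measurable borel"
  by (intro borel_measurable_continuous_onI continuous_intros)

lemma borel_measurable_circle_measure:
  assumes "f \<in> borel_measurable borel"
  shows "f \<in> borel_measurable circle_measure"
  using measurable_restrict_space1[OF assms, of "sphere 0 1"]
  by (simp only: measurable_cong_sets[OF sets_circle_measure refl])

lemma integral_circle_measure_powi:
  "(LINT z|circle_measure. z powi n) = (if n = 0 then 1 else 0)"
proof -
  have cis_meas [measurable]: "(\<lambda>t::real. cis (n * t)) \<in> borel_measurable borel"
  proof -
    have "continuous_on UNIV (\<lambda>t::real. cis (n * t))" by (intro continuous_intros)
    then show ?thesis by (rule borel_measurable_continuous_onI)
  qed
  have "(LINT z|circle_measure. z powi n) = (LINT t|uniform_measure lborel {0..<2 * pi}. cis t powi n)"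
    unfolding circle_measure_def
  proof (rule integral_distr)
    show "cis \<in> uniform_measure lborel {0..<2 * pi} \<rightarrow>\<^sub>M restrict_space borel (sphere 0 1)"
      using measurable_cis_sphere by simp
    show "(\<lambda>z::complex. z powi n) \<in> borel_measurable (restrict_space borel (sphere 0 1))"
      by (intro measurable_restrict_space1) measurable
  qed
  also have "\<dots> = (LINT t|density lborel (\<lambda>t. ennreal (indicator {0..<2 * pi} t / (2 * pi))). cis (n * t))"
  proof -
    have "(\<lambda>t. indicator {0..<2 * pi} t / emeasure lborel {0..<2 * pi}) =
        (\<lambda>t. ennreal (indicator {0..<2 * pi} t / (2 * pi)))"
      by (auto simp: fun_eq_iff indicator_def divide_ennreal simp flip: ennreal_1)
    then show ?thesis
      by (simp add: uniform_measure_def cis_power_int)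
  qed
  also have "\<dots> = (LINT t|lborel. (indicator {0..<2 * pi} t / (2 * pi)) *\<^sub>R cis (n * t))"
    by (intro integral_density) (use cis_meas in auto)
  \<comment> \<open>The fundamental theorem of calculus is applied on a closed interval; the added
    endpoint is a null set.\<close>
  also have "\<dots> = (LINT t|lborel. (1 / (2 * pi)) *\<^sub>R (indicator {0..2 * pi} t *\<^sub>R cis (n * t)))"
  proof (rule integral_cong_AE)
    show "AE t in lborel. (indicator {0..<2 * pi} t / (2 * pi)) *\<^sub>R cis (n * t)
        = (1 / (2 * pi)) *\<^sub>R (indicator {0..2 * pi} t *\<^sub>R cis (n * t))"
      using AE_lborel_singleton[of "2 * pi"] by eventually_elim (auto simp: indicator_def)
  qed auto
  also have "\<dots> = (1 / (2 * pi)) *\<^sub>R (LINT t|lborel. indicator {0..2 * pi} t *\<^sub>R cis (n * t))"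
    by (rule integral_scaleR_right)
  also have "(LINT t|lborel. indicator {0..2 * pi} t *\<^sub>R cis (n * t)) = (if n = 0 then 2 * pi else 0)"
  proof (cases "n = 0")
    case True
    have "(LINT t|lborel. indicator {0..2 * pi} t *\<^sub>R cis (n * t))
        = complex_of_real (2 * pi) - complex_of_real 0"
    proof (rule integral_FTC_Icc)
      show "(complex_of_real has_vector_derivative cis (n * x)) (at x within {0..2 * pi})" for x :: real
        using True by (auto intro!: derivative_eq_intros)
    qed (auto intro!: continuous_intros)
    then show ?thesis using True by simp
  next
    case False
    let ?F = "\<lambda>t::real. cis (n * t) / (\<i> * n)"
    have "(LINT t|lborel. indicator {0..2 * pi} t *\<^sub>R cis (n * t)) = ?F (2 * pi) - ?F 0"
    proof (rule integral_FTC_Icc)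
      show "(?F has_vector_derivative cis (n * x)) (at x within {0..2 * pi})" for x :: real
      proof -
        \<comment> \<open>The antiderivative is differentiated as a holomorphic function and only
          then restricted to the real line.\<close>
        have "((\<lambda>z. exp (\<i> * (n * z)) / (\<i> * n)) has_field_derivative exp (\<i> * (n * of_real x)))
            (at (complex_of_real x))"
        proof -
          have "\<i> * (e * \<i>) = - e" for e by (simp add: complex_eq_iff)
          then show ?thesis using False by (auto intro!: derivative_eq_intros)
        qed
        from has_vector_derivative_real_field[OF this, of "{0..2 * pi}"]
        show ?thesis by (simp add: cis_conv_exp)
      qed
    qed (auto intro!: continuous_intros)
    also have "cis (n * (2 * pi)) = 1"
      using cis_multiple_2pi[of "of_int n"] by (simp add: mult.commute)
    finally show ?thesis using False by simp
  qed
  finally show ?thesis by (auto simp: scaleR_conv_of_real)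
qed

lemma prob_space_torus_measure: "prob_space (torus_measure d)"
  unfolding torus_measure_def by (intro prob_space_PiM prob_space_circle_measure)

lemma norm_torus_coordinate: "z \<in> space (torus_measure d) \<Longrightarrow> j \<in> {1..d} \<Longrightarrow> cmod (z j) = 1"
  by (auto simp: torus_measure_def space_PiM space_circle_measure PiE_def Pi_def)

lemma measurable_torus_coordinate:
  assumes "j \<in> {1..d}"
  shows "(\<lambda>z. z j) \<in> borel_measurable (torus_measure d)"
proof -
  have "(\<lambda>z. z j) \<in> torus_measure d \<rightarrow>\<^sub>M circle_measure"
    unfolding torus_measure_def using assms by (rule measurable_component_singleton)
  then show ?thesis
    using borel_measurable_circle_measure[of "\<lambda>x. x"] measurable_compose[of _ _ _ "\<lambda>x. x"] by fastforce
qed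

lemma torus_monomial_measurable [measurable]:
  "torus_monomial d \<alpha> \<in> borel_measurable (torus_measure d)"
  unfolding torus_monomial_def[abs_def]
  by (intro borel_measurable_prod measurable_compose[OF measurable_torus_coordinate]) measurable

lemma norm_torus_monomial: "z \<in> space (torus_measure d) \<Longrightarrow> cmod (torus_monomial d \<alpha> z) = 1"
  unfolding torus_monomial_def by (auto simp: norm_power_int norm_torus_coordinate simp flip: prod_norm intro!: prod.neutral)

text \<open>Conjugation is inversion on the unit circle, which is why \<open>z\<close> has to lie on
  the torus.\<close>

lemma torus_monomial_mult_cnj:
  assumes "z \<in> space (torus_measure d)"
  shows "torus_monomial d \<alpha> z * cnj (torus_monomial d \<beta> z) = torus_monomial d (\<lambda>j. \<alpha> j - \<beta> j) z"
  unfolding torus_monomial_def cnj_prod prod.distrib[symmetric]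
proof (rule prod.cong)
  fix j assume "j \<in> {1..d}"
  then have "cmod (z j) = 1" using assms by (rule norm_torus_coordinate[rotated])
  moreover from this have "z j \<noteq> 0" by auto
  moreover have "cnj (z j) = inverse (z j)"
    using calculation by (simp add: inverse_eq_divide divide_conv_cnj)
  moreover have "cnj (z j powi \<beta> j) = cnj (z j) powi \<beta> j"
    by (simp add: power_int_def)
  ultimately show "z j powi \<alpha> j * cnj (z j powi \<beta> j) = z j powi (\<alpha> j - \<beta> j)"
    by (simp add: power_int_diff power_int_inverse divide_inverse)
qed simp

text \<open>By Fubini the integral factors over the coordinates. The condition looks only at the
  values on \<open>{1..d}\<close>, since the lemma is applied to differences of multi-indices, which
  need not be extensional.\<close>

lemma integral_torus_monomial:
  "(LINT z|torus_measure d. torus_monomial d \<alpha> z) = (if \<forall>j\<in>{1..d}. \<alpha> j = 0 then 1 else 0)"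
proof -
  interpret C: prob_space circle_measure by (rule prob_space_circle_measure)
  interpret product_sigma_finite "\<lambda>_::nat. circle_measure" ..
  have "integrable circle_measure (\<lambda>z. z powi n)" for n
  proof (rule C.integrable_const_bound[where B = 1])
    show "AE z in circle_measure. norm (z powi n) \<le> 1"
      by (auto simp: norm_power_int space_circle_measure)
  qed (intro borel_measurable_circle_measure borel_measurable_power_int_complex)
  then have "(LINT z|torus_measure d. torus_monomial d \<alpha> z) =
      (\<Prod>j\<in>{1..d}. LINT z|circle_measure. z powi \<alpha> j)"
    unfolding torus_measure_def torus_monomial_def by (intro product_integral_prod) auto
  also have "\<dots> = (if \<forall>j\<in>{1..d}. \<alpha> j = 0 then 1 else 0)"
    by (auto simp: integral_circle_measure_powi)
  finally show ?thesis .
qed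

text \<open>The multinomial expansion indexed by words: every word has weight 1, so later
  coefficients are found by counting words.\<close>

lemma sum_power_eq_sum_lists:
  fixes g :: "'a \<Rightarrow> 'b::comm_semiring_1"
  assumes "finite S"
  shows "(\<Sum>x\<in>S. g x) ^ n = (\<Sum>xs | set xs \<subseteq> S \<and> length xs = n. prod_list (map g xs))"
proof (induction n)
  case 0
  have "{xs. set xs \<subseteq> S \<and> length xs = 0} = {[]}" by auto
  then show ?case by simp
next
  case (Suc n)
  let ?L = "{xs. set xs \<subseteq> S \<and> length xs = n}"
  have eq: "{xs. set xs \<subseteq> S \<and> length xs = Suc n} = (\<lambda>(x, xs). x # xs) ` (S \<times> ?L)"
    by (auto simp: length_Suc_conv image_iff)
  have "(\<Sum>xs | set xs \<subseteq> S \<and> length xs = Suc n. prod_list (map g xs)) =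
      (\<Sum>(x, xs)\<in>S \<times> ?L. g x * prod_list (map g xs))"
    unfolding eq by (subst sum.reindex) (auto simp: inj_on_def case_prod_unfold)
  also have "\<dots> = (\<Sum>x\<in>S. g x) * (\<Sum>xs\<in>?L. prod_list (map g xs))"
    by (simp add: sum_product sum.cartesian_product)
  finally show ?case using Suc by simp
qed

text \<open>The frequency on the torus of the monomial spelled by \<open>xs\<close> times the
  conjugate of the one spelled by \<open>ys\<close>, whose letters count negatively because
  conjugation inverts. The restriction to \<open>{1..d}\<close> places it in
  \<open>multi_indices d\<close>.\<close>

definition list_index :: "nat \<Rightarrow> nat list \<Rightarrow> nat list \<Rightarrow> nat \<Rightarrow> int" where
  "list_index d xs ys = (\<lambda>j\<in>{1..d}. int (count (mset xs) j) - int (count (mset ys) j))"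

definition unit_index :: "nat \<Rightarrow> nat \<Rightarrow> nat \<Rightarrow> int" where
  "unit_index d m = (\<lambda>j\<in>{1..d}. of_bool (j = m))"

lemma torus_monomial_unit_index: "m \<in> {1..d} \<Longrightarrow> torus_monomial d (unit_index d m) z = z m"
proof -
  assume m: "m \<in> {1..d}"
  have "torus_monomial d (unit_index d m) z = (\<Prod>j\<in>{1..d}. if j = m then z j else 1)"
    unfolding torus_monomial_def unit_index_def by (intro prod.cong) auto
  then show ?thesis using m by simp
qed

lemma prod_list_eq_prod_count:
  fixes z :: "'a \<Rightarrow> 'b::comm_monoid_mult"
  assumes "finite A" "set xs \<subseteq> A"
  shows "prod_list (map z xs) = (\<Prod>j\<in>A. z j ^ count (mset xs) j)"
  using assms(2)
proof (induction xs)
  case (Cons x xs)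
  have "(\<Prod>j\<in>A. z j ^ count (mset (x # xs)) j) =
      (\<Prod>j\<in>A. (if j = x then z j else 1) * z j ^ count (mset xs) j)"
    by (intro prod.cong) auto
  also have "\<dots> = z x * (\<Prod>j\<in>A. z j ^ count (mset xs) j)"
    using assms(1) Cons.prems by (simp add: prod.distrib)
  finally show ?case using Cons by simp
qed simp

lemma torus_monomial_list_index:
  assumes z: "z \<in> space (torus_measure d)" and "set xs \<subseteq> {1..d}" "set ys \<subseteq> {1..d}"
  shows "torus_monomial d (list_index d xs ys) z = prod_list (map z xs) * cnj (prod_list (map z ys))"
proof -
  have "prod_list (map z us) = torus_monomial d (\<lambda>j. int (count (mset us) j)) z"
    if "set us \<subseteq> {1..d}" for us
    using prod_list_eq_prod_count[OF _ that] by (simp add: torus_monomial_def)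
  moreover have "torus_monomial d (list_index d xs ys) z =
      torus_monomial d (\<lambda>j. int (count (mset xs) j) - int (count (mset ys) j)) z"
    by (simp add: torus_monomial_def list_index_def)
  ultimately show ?thesis
    using assms by (simp add: torus_monomial_mult_cnj)
qed

lemma list_index_add_mset:
  "mset xs = add_mset m (mset ys) \<Longrightarrow> list_index d xs ys = unit_index d m"
  by (auto simp: list_index_def unit_index_def fun_eq_iff)

text \<open>Nonnegativity makes \<open>ys\<close> a submultiset of \<open>xs\<close>; as the lengths
  differ by one, exactly one letter is left over. Hence a function with nonnegative spectrum sees
  only the frequencies of the coordinates themselves.\<close>

lemma list_index_nonneg:
  assumes "list_index d xs ys \<in> nonneg_multi_indices d"
    and "set xs \<subseteq> {1..d}" "set ys \<subseteq> {1..d}" "length xs = Suc (length ys)"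
  obtains m where "m \<in> set xs" "mset xs = add_mset m (mset ys)"
proof -
  have "count (mset ys) j \<le> count (mset xs) j" for j
  proof (cases "j \<in> {1..d}")
    case True
    then have "0 \<le> list_index d xs ys j"
      using assms(1) by (auto simp: nonneg_multi_indices_def PiE_def Pi_def)
    then show ?thesis using True by (simp add: list_index_def)
  next
    case False
    then show ?thesis using assms by (metis count_mset_0_iff le0 subsetD)
  qed
  then have sub: "mset ys \<subseteq># mset xs" by (simp add: mset_subset_eqI)
  then have "size (mset xs - mset ys) = 1"
    using assms by (simp add: size_Diff_submset)
  then obtain m where "mset xs - mset ys = {#m#}"
    using size_1_singleton_mset by blast
  then have "mset xs = add_mset m (mset ys)"
    using sub by (metis add_mset_add_single subset_mset.add_diff_inverse)
  moreover from this have "m \<in> set xs" by (metis set_mset_mset union_single_eq_member)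
  ultimately show thesis using that by blast
qed

section \<open>Pairing with a linear form times a power of its modulus\<close>

lemma integrable_mult_bounded:
  fixes f g :: "'a \<Rightarrow> complex"
  assumes "integrable M f" "g \<in> borel_measurable M" "\<And>x. x \<in> space M \<Longrightarrow> norm (g x) \<le> B"
  shows "integrable M (\<lambda>x. f x * g x)"
proof (rule Bochner_Integration.integrable_bound[where f = "\<lambda>x. B * norm (f x)"])
  show "AE x in M. norm (f x * g x) \<le> norm (B * norm (f x))"
  proof (rule AE_I2)
    fix x assume "x \<in> space M"
    then have "norm (g x) \<le> B" by (rule assms(3))
    moreover from this have "0 \<le> B" using norm_ge_zero order_trans by blast
    ultimately show "norm (f x * g x) \<le> norm (B * norm (f x))"
      using mult_left_mono[of "norm (g x)" B "norm (f x)"] by (simp add: norm_mult mult.commute)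
  qed
qed (use assms in auto)

lemma prod_list_mult_cnj:
  assumes "\<And>x. x \<in> set xs \<Longrightarrow> cmod (c x) = \<rho>"
  shows "prod_list (map c xs) * cnj (prod_list (map c xs)) = of_real (\<rho> ^ (2 * length xs))"
  using assms
proof (induction xs)
  case (Cons x xs)
  have "prod_list (map c (x # xs)) * cnj (prod_list (map c (x # xs))) =
      (c x * cnj (c x)) * (prod_list (map c xs) * cnj (prod_list (map c xs)))"
    by simp
  also have "c x * cnj (c x) = of_real (\<rho>\<^sup>2)"
    using Cons.prems by (simp add: complex_norm_square[symmetric])
  finally show ?case using Cons by (simp add: power2_eq_square mult.assoc)
qed simp

text \<open>The bijection is relabelling by the transposition of \<open>m\<close> and \<open>m'\<close>.\<close>

lemma card_list_pairs_eq:
  fixes S :: "'a set" and a b :: nat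
  assumes "m \<in> S" "m' \<in> S"
  defines "P \<equiv> \<lambda>m. {(xs, ys). (set xs \<subseteq> S \<and> length xs = a) \<and> (set ys \<subseteq> S \<and> length ys = b) \<and>
      mset xs = add_mset m (mset ys)}"
  shows "card (P m) = card (P m')"
proof (rule bij_betw_same_card)
  define \<tau> where "\<tau> = Transposition.transpose m m'"
  have [simp]: "\<tau> (\<tau> x) = x" "\<tau> m = m'" "\<tau> m' = m" for x by (auto simp: \<tau>_def)
  have [simp]: "map (\<tau> \<circ> \<tau>) xs = xs" for xs by (simp add: o_def)
  have \<tau>_S: "\<tau> x \<in> S" if "x \<in> S" for x using that assms(1,2) by (auto simp: \<tau>_def Transposition.transpose_def)
  show "bij_betw (\<lambda>(xs, ys). (map \<tau> xs, map \<tau> ys)) (P m) (P m')"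
    by (intro bij_betw_byWitness[where f' = "\<lambda>(xs, ys). (map \<tau> xs, map \<tau> ys)"])
      (auto simp: P_def intro!: \<tau>_S)
qed

text \<open>The pairing becomes a sum over pairs of words, and only pairs in some \<open>P m\<close>
  can contribute. Each of them contributes the conjugate of \<open>c m\<close> times
  \<open>\<rho> ^ (2 * k)\<close> times the coefficient of \<open>f\<close> at the frequency of z_m.
  All \<open>P m\<close> have the same size, so the constants factor out and the pairing with
  \<open>\<phi> S\<close> is left.\<close>

lemma torus_inner_linear_form_power:
  fixes f :: "(nat \<Rightarrow> complex) \<Rightarrow> complex" and c :: "nat \<Rightarrow> complex"
  defines "\<phi> \<equiv> \<lambda>S z. \<Sum>j\<in>S. c j * z j"
  assumes f: "integrable (torus_measure d) f"
    and coeff: "\<And>\<alpha>. \<alpha> \<in> multi_indices d - nonneg_multi_indices d \<Longrightarrow> fourier_coeff d f \<alpha> = 0"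
    and S: "S \<subseteq> {1..d}" and \<rho>: "\<And>j. j \<in> S \<Longrightarrow> cmod (c j) = \<rho>"
    and orth: "torus_inner d f (\<phi> S) = 0"
  shows "torus_inner d f (\<lambda>z. \<phi> S z * of_real (((cmod (\<phi> S z))\<^sup>2) ^ k)) = 0"
proof -
  let ?T = "torus_measure d"
  define L where "L n = {xs. set xs \<subseteq> S \<and> length xs = n}" for n
  define C where "C = (\<lambda>(xs, ys). prod_list (map c xs) * cnj (prod_list (map c ys)))"
  define \<alpha> where "\<alpha> = (\<lambda>(xs, ys). list_index d xs ys)"
  define P where "P m = {(xs, ys). (set xs \<subseteq> S \<and> length xs = Suc k) \<and> (set ys \<subseteq> S \<and> length ys = k) \<and>
      mset xs = add_mset m (mset ys)}" for m
  have finS: "finite S" using S finite_subset by blast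
  then have finL: "finite (L n)" for n unfolding L_def by (rule finite_lists_length_eq)
  have int: "integrable ?T (\<lambda>z. f z * cnj (torus_monomial d \<beta> z))" for \<beta>
  proof (rule integrable_mult_bounded[OF f])
    show "(\<lambda>z. cnj (torus_monomial d \<beta> z)) \<in> borel_measurable ?T" by measurable
    show "cmod (cnj (torus_monomial d \<beta> z)) \<le> 1" if "z \<in> space ?T" for z
      using that by (simp add: norm_torus_monomial)
  qed

  have expand: "\<phi> S z * of_real (((cmod (\<phi> S z))\<^sup>2) ^ k) =
      (\<Sum>p\<in>L (Suc k) \<times> L k. C p * torus_monomial d (\<alpha> p) z)" if z: "z \<in> space ?T" for z
  proof -
    have pow: "\<phi> S z ^ n = (\<Sum>xs\<in>L n. prod_list (map c xs) * prod_list (map z xs))" for n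
    proof -
      have "prod_list (map (\<lambda>j. c j * z j) xs) = prod_list (map c xs) * prod_list (map z xs)" for xs
        by (induction xs) auto
      then show ?thesis
        unfolding \<phi>_def L_def by (simp add: sum_power_eq_sum_lists[OF finS])
    qed
    have "\<phi> S z * of_real (((cmod (\<phi> S z))\<^sup>2) ^ k) = \<phi> S z ^ Suc k * cnj (\<phi> S z ^ k)"
    proof -
      have "of_real (((cmod (\<phi> S z))\<^sup>2) ^ k) = (\<phi> S z * cnj (\<phi> S z)) ^ k"
        unfolding complex_norm_square[symmetric] by simp
      then show ?thesis by (simp add: power_mult_distrib)
    qed
    also have "\<dots> = (\<Sum>(xs, ys)\<in>L (Suc k) \<times> L k.
        (prod_list (map c xs) * prod_list (map z xs)) * cnj (prod_list (map c ys) * prod_list (map z ys)))"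
      unfolding pow cnj_sum sum_product sum.cartesian_product by simp
    also have "\<dots> = (\<Sum>p\<in>L (Suc k) \<times> L k. C p * torus_monomial d (\<alpha> p) z)"
    proof (intro sum.cong refl)
      fix p assume "p \<in> L (Suc k) \<times> L k"
      then obtain xs ys where p: "p = (xs, ys)" and "set xs \<subseteq> S" "set ys \<subseteq> S" by (auto simp: L_def)
      then have "set xs \<subseteq> {1..d}" "set ys \<subseteq> {1..d}" using S by auto
      then show "(case p of (xs, ys) \<Rightarrow> (prod_list (map c xs) * prod_list (map z xs)) *
          cnj (prod_list (map c ys) * prod_list (map z ys))) = C p * torus_monomial d (\<alpha> p) z"
        by (simp add: p C_def \<alpha>_def torus_monomial_list_index[OF z])
    qed
    finally show ?thesis .
  qed

  \<comment> \<open>At most one summand over \<open>m\<close> is nonzero. In this form the double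
    sum can be swapped, which groups the pairs of words by their surviving frequency.\<close>
  have term_eq: "cnj (C p) * fourier_coeff d f (\<alpha> p) = (\<Sum>m\<in>S. if p \<in> P m
        then cnj (c m) * of_real (\<rho> ^ (2 * k)) * fourier_coeff d f (unit_index d m) else 0)"
    if p: "p \<in> L (Suc k) \<times> L k" for p
  proof -
    obtain xs ys where p_eq: "p = (xs, ys)" and xs: "set xs \<subseteq> S" "length xs = Suc k"
      and ys: "set ys \<subseteq> S" "length ys = k"
      using p by (auto simp: L_def)
    show ?thesis
    proof (cases "\<exists>m\<in>S. mset xs = add_mset m (mset ys)")
      case True
      then obtain m where m: "m \<in> S" "mset xs = add_mset m (mset ys)" by blast
      have "p \<in> P m' \<longleftrightarrow> m' = m" for m'
        using xs ys m by (auto simp: P_def p_eq)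
      moreover have "C p = c m * of_real (\<rho> ^ (2 * k))"
      proof -
        \<comment> \<open>Up to order \<open>xs\<close> is \<open>ys\<close> with \<open>m\<close>
          added, so in \<open>C p\<close> every letter of \<open>ys\<close> meets its own
          conjugate.\<close>
        have "prod_list (map c xs) = c m * prod_list (map c ys)"
          using m by (simp flip: prod_mset_prod_list)
        then show ?thesis
          using prod_list_mult_cnj[of ys c \<rho>] \<rho> ys by (auto simp: C_def p_eq mult.assoc)
      qed
      moreover have "\<alpha> p = unit_index d m"
        using list_index_add_mset[OF m(2)] by (simp add: \<alpha>_def p_eq)
      ultimately show ?thesis using m finS by simp
    next
      case False
      have "\<alpha> p \<notin> nonneg_multi_indices d"
      proof
        assume "\<alpha> p \<in> nonneg_multi_indices d"
        then have "list_index d xs ys \<in> nonneg_multi_indices d" by (simp add: \<alpha>_def p_eq)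
        moreover have "set xs \<subseteq> {1..d}" "set ys \<subseteq> {1..d}" "length xs = Suc (length ys)"
          using xs ys S by auto
        ultimately obtain m where "m \<in> set xs" "mset xs = add_mset m (mset ys)"
          by (rule list_index_nonneg)
        then show False using False xs by blast
      qed
      moreover have "\<alpha> p \<in> multi_indices d"
        by (simp add: \<alpha>_def p_eq list_index_def multi_indices_def)
      ultimately have "fourier_coeff d f (\<alpha> p) = 0" using coeff by blast
      then show ?thesis using False by (auto simp: P_def p_eq intro!: sum.neutral)
    qed
  qed

  have P_sub: "P m \<subseteq> L (Suc k) \<times> L k" for m by (auto simp: P_def L_def)
  \<comment> \<open>Any letter of \<open>S\<close> yields the same count. If \<open>S\<close> is
    empty, the value of \<open>N\<close> is arbitrary, but it then multiplies an empty sum.\<close>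
  define N where "N = card (P (SOME m. m \<in> S))"
  have N: "card (P m) = N" if "m \<in> S" for m
    unfolding P_def N_def using that someI[of "\<lambda>m. m \<in> S", OF that] by (rule card_list_pairs_eq)

  have "torus_inner d f (\<lambda>z. \<phi> S z * of_real (((cmod (\<phi> S z))\<^sup>2) ^ k)) =
      (LINT z|?T. (\<Sum>p\<in>L (Suc k) \<times> L k. cnj (C p) * (f z * cnj (torus_monomial d (\<alpha> p) z))))"
    unfolding torus_inner_def
  proof (intro Bochner_Integration.integral_cong refl)
    fix z assume z: "z \<in> space ?T"
    show "f z * cnj (\<phi> S z * of_real (((cmod (\<phi> S z))\<^sup>2) ^ k)) =
        (\<Sum>p\<in>L (Suc k) \<times> L k. cnj (C p) * (f z * cnj (torus_monomial d (\<alpha> p) z)))"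
      unfolding expand[OF z] cnj_sum sum_distrib_left
      by (intro sum.cong refl) (simp only: complex_cnj_mult mult_ac)
  qed
  also have "\<dots> = (\<Sum>p\<in>L (Suc k) \<times> L k. cnj (C p) * fourier_coeff d f (\<alpha> p))"
    unfolding fourier_coeff_def using int by (subst Bochner_Integration.integral_sum) auto
  also have "\<dots> = (\<Sum>p\<in>L (Suc k) \<times> L k. \<Sum>m\<in>S. if p \<in> P m
        then cnj (c m) * of_real (\<rho> ^ (2 * k)) * fourier_coeff d f (unit_index d m) else 0)"
    by (intro sum.cong refl term_eq)
  also have "\<dots> = (\<Sum>m\<in>S. \<Sum>p\<in>L (Suc k) \<times> L k. if p \<in> P m
        then cnj (c m) * of_real (\<rho> ^ (2 * k)) * fourier_coeff d f (unit_index d m) else 0)"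
    by (rule sum.swap)
  also have "\<dots> = (\<Sum>m\<in>S. of_nat (card (P m)) *
        (cnj (c m) * of_real (\<rho> ^ (2 * k)) * fourier_coeff d f (unit_index d m)))"
  proof (rule sum.cong[OF refl])
    fix m
    show "(\<Sum>p\<in>L (Suc k) \<times> L k. if p \<in> P m
        then cnj (c m) * of_real (\<rho> ^ (2 * k)) * fourier_coeff d f (unit_index d m) else 0) =
      of_nat (card (P m)) * (cnj (c m) * of_real (\<rho> ^ (2 * k)) * fourier_coeff d f (unit_index d m))"
      using finL P_sub[of m] by (subst sum.inter_restrict[symmetric]) (simp_all only: finite_cartesian_product Int_absorb1 sum_constant)
  qed
  also have "\<dots> = of_nat N * of_real (\<rho> ^ (2 * k)) * (\<Sum>m\<in>S. cnj (c m) * fourier_coeff d f (unit_index d m))"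
    unfolding sum_distrib_left by (intro sum.cong refl) (simp only: N mult_ac)
  also have "(\<Sum>m\<in>S. cnj (c m) * fourier_coeff d f (unit_index d m)) = torus_inner d f (\<phi> S)"
  proof -
    have "torus_inner d f (\<phi> S) =
        (LINT z|?T. (\<Sum>m\<in>S. cnj (c m) * (f z * cnj (torus_monomial d (unit_index d m) z))))"
      unfolding torus_inner_def \<phi>_def using S
      by (intro Bochner_Integration.integral_cong refl)
        (auto simp: sum_distrib_left mult.left_commute mult.commute torus_monomial_unit_index intro!: sum.cong)
    also have "\<dots> = (\<Sum>m\<in>S. cnj (c m) * fourier_coeff d f (unit_index d m))"
      unfolding fourier_coeff_def using int by (subst Bochner_Integration.integral_sum) auto
    finally show ?thesis by simp
  qed
  finally show ?thesis using orth by simp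
qed

section \<open>Convexity and Lebesgue spaces\<close>

text \<open>Convexity is used on the open half-line, where the power is differentiable. At the
  endpoint \<open>t = 0\<close> the claim reduces to (1 - r) s^r <= 0.\<close>

lemma powr_above_tangent:
  fixes s t r :: real
  assumes "0 < s" "0 \<le> t" "1 \<le> r"
  shows "s powr r + r * s powr (r - 1) * (t - s) \<le> t powr r"
proof (cases "t = 0")
  case True
  have "s powr (r - 1) * s = s powr r"
    using assms by (simp add: powr_diff)
  then have "s powr r + r * s powr (r - 1) * (t - s) = (1 - r) * s powr r"
    using True by (simp add: algebra_simps)
  also have "\<dots> \<le> 0" using assms by (intro mult_nonpos_nonneg) auto
  finally show ?thesis using True by simp
next
  case False
  have "t powr r - s powr r \<ge> (r * s powr (r - 1)) * (t - s)"
  proof (rule convex_on_imp_above_tangent[where A = "{0<..}"])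
    show "convex_on {0<..} (\<lambda>x. x powr r)" using assms by (intro powr_convex)
    show "((\<lambda>x. x powr r) has_real_derivative r * s powr (r - 1)) (at s within {0<..})"
      using assms(1) by (intro has_field_derivative_at_within[OF has_real_derivative_powr])
  qed (use assms False in \<open>auto simp: interior_open\<close>)
  then show ?thesis by simp
qed

text \<open>The supporting hyperplane of |.|^r at \<open>a\<close>, whose real gradient is r a
  |a|^(r-2). Projecting \<open>a + w\<close> onto the direction of \<open>a\<close> reduces it to
  the tangent inequality for the moduli. At \<open>a = 0\<close> the linear term vanishes, which is
  a valid subgradient even for \<open>r = 1\<close>.\<close>

lemma norm_powr_above_tangent:
  fixes a w :: complex and r :: real
  assumes "1 \<le> r"
  shows "cmod a powr r + r * Re (w * cnj (a * of_real (cmod a powr (r - 2)))) \<le> cmod (a + w) powr r"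
proof (cases "a = 0")
  case False
  then have pos: "0 < cmod a" by simp
  have "Re ((a + w) * cnj a) \<le> cmod (a + w) * cmod a"
    using complex_Re_le_cmod[of "(a + w) * cnj a"] by (simp add: norm_mult)
  moreover have "Re (a * cnj a) = cmod a * cmod a"
    by (metis Re_complex_of_real complex_norm_square of_real_power power2_eq_square)
  ultimately have *: "Re (w * cnj a) \<le> cmod a * (cmod (a + w) - cmod a)"
    by (simp add: algebra_simps)
  have "Re (w * cnj (a * of_real (cmod a powr (r - 2)))) = cmod a powr (r - 2) * Re (w * cnj a)"
    by (simp add: algebra_simps)
  also have "\<dots> \<le> cmod a powr (r - 2) * (cmod a * (cmod (a + w) - cmod a))"
    using * by (intro mult_left_mono) auto
  also have "\<dots> = cmod a powr (r - 1) * (cmod (a + w) - cmod a)"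
    using pos powr_add[of "cmod a" "r - 2" 1] by simp
  finally have "r * Re (w * cnj (a * of_real (cmod a powr (r - 2)))) \<le>
      r * (cmod a powr (r - 1) * (cmod (a + w) - cmod a))"
    using assms by (intro mult_left_mono) auto
  then show ?thesis
    using powr_above_tangent[OF pos norm_ge_zero assms, of "a + w"] unfolding mult.assoc by linarith
qed (use assms in simp)

text \<open>Jensen's inequality: when the tangent at the mean \<open>s\<close> is integrated, its
  linear term drops out.\<close>

lemma (in prob_space) integral_le_integral_powr:
  fixes u :: "'a \<Rightarrow> real"
  assumes u: "integrable M u" "\<And>x. 0 \<le> u x" and r: "1 \<le> r" and ur: "integrable M (\<lambda>x. u x powr r)"
  shows "(LINT x|M. u x) \<le> (LINT x|M. u x powr r) powr (1 / r)"
proof (cases "(LINT x|M. u x) = 0")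
  case False
  define s where "s = (LINT x|M. u x)"
  have s: "0 < s"
    using False u(2) by (simp add: s_def less_le Bochner_Integration.integral_nonneg)
  have "s powr r = (LINT x|M. s powr r + r * s powr (r - 1) * (u x - s))"
    using u(1) by (simp add: s_def[symmetric] prob_space)
  also have "\<dots> \<le> (LINT x|M. u x powr r)"
    using u ur r s by (intro integral_mono powr_above_tangent) auto
  finally have "(s powr r) powr (1 / r) \<le> (LINT x|M. u x powr r) powr (1 / r)"
    using r by (intro powr_mono2) auto
  then show ?thesis using s r by (simp add: s_def[symmetric] powr_powr)
qed simp

lemma enn2real_ge_1: "1 \<le> p \<Longrightarrow> p \<noteq> \<infinity> \<Longrightarrow> 1 \<le> enn2real p"
  by (metis enn2real_mono ennreal_1 enn2real_1 infinity_ennreal_def top.not_eq_extremum)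

lemma AE_norm_le_esssup:
  assumes "esssup M (\<lambda>x. ennreal (norm (f x))) < \<infinity>"
  shows "AE x in M. norm (f x) \<le> enn2real (esssup M (\<lambda>x. ennreal (norm (f x))))"
  using esssup_AE[of "\<lambda>x. ennreal (norm (f x))" M]
proof eventually_elim
  case (elim x)
  from enn2real_mono[OF elim] assms show ?case by simp
qed

lemma (in finite_measure) integrable_Lp_space:
  assumes f: "f \<in> Lp_space M p" and p: "1 \<le> p"
  shows "integrable M f"
proof (cases "p = \<infinity>")
  case True
  then have "f \<in> borel_measurable M" and fin: "esssup M (\<lambda>x. ennreal (norm (f x))) < \<infinity>"
    using f by (auto simp: Lp_space_def)
  then show ?thesis
    using AE_norm_le_esssup[OF fin] by (intro integrable_const_bound) auto
next
  case False
  define r where "r = enn2real p"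
  have r: "1 \<le> r" using enn2real_ge_1[OF p False] by (simp add: r_def)
  have meas: "f \<in> borel_measurable M" and int: "integrable M (\<lambda>x. norm (f x) powr r)"
    using f False by (auto simp: Lp_space_def r_def)
  show ?thesis
  proof (rule Bochner_Integration.integrable_bound[where f = "\<lambda>x. 1 + norm (f x) powr r"])
    have "norm (f x) \<le> 1 + norm (f x) powr r" for x
    proof (cases "norm (f x) \<le> 1")
      case False
      then show ?thesis using powr_mono[of 1 r "norm (f x)"] r by simp
    qed (simp add: add_increasing2)
    then show "AE x in M. norm (f x) \<le> norm (1 + norm (f x) powr r)"
      by (intro AE_I2) (simp add: abs_of_nonneg)
  qed (use int meas in auto)
qed

text \<open>A weak substitute for Minkowski's inequality. It suffices because the functions added
  below, the linear form and analytic polynomials, are bounded on the torus.\<close>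

lemma (in finite_measure) Lp_space_add_bounded:
  assumes f: "f \<in> Lp_space M p" and p: "1 \<le> p"
    and g: "g \<in> borel_measurable M" "\<And>x. x \<in> space M \<Longrightarrow> norm (g x) \<le> B"
  shows "(\<lambda>x. f x + g x) \<in> Lp_space M p"
proof (cases "p = \<infinity>")
  case True
  then have f_meas: "f \<in> borel_measurable M" and fin: "esssup M (\<lambda>x. ennreal (norm (f x))) < \<infinity>"
    using f by (auto simp: Lp_space_def)
  let ?E = "enn2real (esssup M (\<lambda>x. ennreal (norm (f x))))"
  have "AE x in M. ennreal (norm (f x + g x)) \<le> ennreal (?E + B)"
    using AE_norm_le_esssup[OF fin] AE_space
  proof eventually_elim
    case (elim x)
    then show ?case
      using g(2)[of x] norm_triangle_ineq[of "f x" "g x"] by (intro ennreal_leI) linarith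
  qed
  then have "esssup M (\<lambda>x. ennreal (norm (f x + g x))) \<le> ennreal (?E + B)"
    using f_meas g(1) by (intro esssup_I) auto
  then have "esssup M (\<lambda>x. ennreal (norm (f x + g x))) < \<infinity>"
    using le_less_trans by fastforce
  then show ?thesis using True f_meas g(1) by (simp add: Lp_space_def)
next
  case False
  define r where "r = enn2real p"
  have r: "1 \<le> r" using enn2real_ge_1[OF p False] by (simp add: r_def)
  have f_meas [measurable]: "f \<in> borel_measurable M" and int: "integrable M (\<lambda>x. norm (f x) powr r)"
    using f False by (auto simp: Lp_space_def r_def)
  note g(1) [measurable]
  have "integrable M (\<lambda>x. norm (f x + g x) powr r)"
  proof (rule Bochner_Integration.integrable_bound
      [where f = "\<lambda>x. (2 powr r) * (norm (f x) powr r + \<bar>B\<bar> powr r)"])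
    show "AE x in M. norm (norm (f x + g x) powr r) \<le>
        norm ((2 powr r) * (norm (f x) powr r + \<bar>B\<bar> powr r))"
    proof (rule AE_I2)
      fix x assume x: "x \<in> space M"
      have "norm (f x + g x) \<le> norm (f x) + \<bar>B\<bar>"
        using norm_triangle_ineq[of "f x" "g x"] g(2)[OF x] by linarith
      also have "\<dots> \<le> 2 * max (norm (f x)) \<bar>B\<bar>" by simp
      finally have "norm (f x + g x) powr r \<le> (2 * max (norm (f x)) \<bar>B\<bar>) powr r"
        using r by (intro powr_mono2) auto
      also have "\<dots> = 2 powr r * max (norm (f x)) \<bar>B\<bar> powr r" by (simp add: powr_mult)
      also have "\<dots> \<le> 2 powr r * (norm (f x) powr r + \<bar>B\<bar> powr r)"
        by (intro mult_left_mono) (auto simp: max_def)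
      finally show "norm (norm (f x + g x) powr r) \<le>
          norm ((2 powr r) * (norm (f x) powr r + \<bar>B\<bar> powr r))" by simp
    qed
  qed (use int in auto)
  then show ?thesis using False by (simp add: Lp_space_def r_def[symmetric])
qed

lemma Lp_norm_top_le:
  assumes "f \<in> borel_measurable M" "AE x in M. norm (f x) \<le> B" "0 \<le> B"
  shows "Lp_norm M \<infinity> f \<le> B"
proof -
  have "esssup M (\<lambda>x. ennreal (norm (f x))) \<le> ennreal B"
    using assms by (intro esssup_I) (auto elim!: eventually_mono intro: ennreal_leI)
  then have "enn2real (esssup M (\<lambda>x. ennreal (norm (f x)))) \<le> enn2real (ennreal B)"
    by (rule enn2real_mono) simp
  then show ?thesis using assms by (simp add: Lp_norm_def)
qed

section \<open>Orthogonality to the linear form times a function of its modulus\<close>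

locale equimodular_linear_form =
  fixes d :: nat and c :: "nat \<Rightarrow> complex" and S :: "nat set" and \<rho> :: real
  assumes subset: "S \<subseteq> {1..d}" and modulus: "\<And>j. j \<in> S \<Longrightarrow> cmod (c j) = \<rho>"
begin

sublocale prob_space "torus_measure d" by (rule prob_space_torus_measure)

definition \<phi> :: "(nat \<Rightarrow> complex) \<Rightarrow> complex" where "\<phi> z = (\<Sum>j\<in>S. c j * z j)"

text \<open>A bound for the modulus of \<open>\<phi>\<close> on the torus, so that its square ranges
  in \<open>{0..K\<^sup>2}\<close>, the interval on which polynomial approximation takes
  place.\<close>

definition K :: real where "K = (\<Sum>j\<in>S. cmod (c j))"

text \<open>As \<open>\<phi>\<close> is bounded, the pairing with \<open>\<phi>\<close> makes sense on all of \<open>H\<^sup>1\<close>; this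
  allows a treatment that is uniform in \<open>p\<close>.\<close>

definition annihilated :: "((nat \<Rightarrow> complex) \<Rightarrow> complex) \<Rightarrow> bool" where
  "annihilated f \<longleftrightarrow> integrable (torus_measure d) f \<and>
     (\<forall>\<alpha> \<in> multi_indices d - nonneg_multi_indices d. fourier_coeff d f \<alpha> = 0) \<and> torus_inner d f \<phi> = 0"

lemma K_nonneg: "0 \<le> K"
  unfolding K_def by (intro sum_nonneg) auto

lemma measurable_\<phi> [measurable]: "\<phi> \<in> borel_measurable (torus_measure d)"
  unfolding \<phi>_def[abs_def] using subset
  by (intro borel_measurable_sum borel_measurable_times measurable_torus_coordinate) auto

lemma norm_\<phi>_le: "z \<in> space (torus_measure d) \<Longrightarrow> cmod (\<phi> z) \<le> K"
  unfolding \<phi>_def K_def using subset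
  by (intro sum_norm_le) (auto simp: norm_mult norm_torus_coordinate)

lemma norm_\<phi>_square_mem: "z \<in> space (torus_measure d) \<Longrightarrow> (cmod (\<phi> z))\<^sup>2 \<in> {0..K\<^sup>2}"
  using norm_\<phi>_le by (auto intro: power_mono)

lemma annihilated_power:
  "annihilated f \<Longrightarrow> torus_inner d f (\<lambda>z. \<phi> z * of_real (((cmod (\<phi> z))\<^sup>2) ^ k)) = 0"
  using torus_inner_linear_form_power[of d f S c \<rho> k] subset modulus
  unfolding annihilated_def \<phi>_def[abs_def] by auto

lemma integrable_mult_\<phi>:
  assumes f: "integrable (torus_measure d) f"
    and h: "h \<in> borel_measurable borel" "\<And>x. x \<in> {0..K\<^sup>2} \<Longrightarrow> \<bar>h x\<bar> \<le> B"
  shows "integrable (torus_measure d) (\<lambda>z. f z * cnj (\<phi> z * of_real (h ((cmod (\<phi> z))\<^sup>2))))"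
proof (rule integrable_mult_bounded[OF f])
  note h(1) [measurable]
  show "(\<lambda>z. cnj (\<phi> z * of_real (h ((cmod (\<phi> z))\<^sup>2)))) \<in> borel_measurable (torus_measure d)"
    by measurable
  show "norm (cnj (\<phi> z * of_real (h ((cmod (\<phi> z))\<^sup>2)))) \<le> K * B" if "z \<in> space (torus_measure d)" for z
  proof -
    have "cmod (\<phi> z) * \<bar>h ((cmod (\<phi> z))\<^sup>2)\<bar> \<le> K * B"
      using norm_\<phi>_le[OF that] h(2)[OF norm_\<phi>_square_mem[OF that]] K_nonneg
      by (intro mult_mono) auto
    then show ?thesis by (simp add: norm_mult)
  qed
qed

lemma annihilated_polynomial:
  assumes f: "annihilated f" and q: "real_polynomial_function q"
  shows "torus_inner d f (\<lambda>z. \<phi> z * of_real (q ((cmod (\<phi> z))\<^sup>2))) = 0"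
proof -
  obtain a n where q: "q = (\<lambda>x. \<Sum>i\<le>n. a i * x ^ i)"
    using q real_polynomial_function_iff_sum by auto
  have "torus_inner d f (\<lambda>z. \<phi> z * of_real (q ((cmod (\<phi> z))\<^sup>2))) =
      (LINT z|torus_measure d. (\<Sum>i\<le>n. of_real (a i) * (f z * cnj (\<phi> z * of_real (((cmod (\<phi> z))\<^sup>2) ^ i)))))"
    unfolding torus_inner_def q by (intro Bochner_Integration.integral_cong refl)
      (simp add: sum_distrib_left mult_ac)
  also have "\<dots> = (\<Sum>i\<le>n. of_real (a i) * torus_inner d f (\<lambda>z. \<phi> z * of_real (((cmod (\<phi> z))\<^sup>2) ^ i)))"
  proof -
    have "integrable (torus_measure d) (\<lambda>z. f z * cnj (\<phi> z * of_real (((cmod (\<phi> z))\<^sup>2) ^ i)))" for i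
      using f by (intro integrable_mult_\<phi>[where B = "(K\<^sup>2) ^ i"])
        (auto simp: annihilated_def abs_of_nonneg intro: power_mono)
    then show ?thesis
      unfolding torus_inner_def by (subst Bochner_Integration.integral_sum) auto
  qed
  also have "\<dots> = 0" using annihilated_power[OF f] by simp
  finally show ?thesis .
qed

text \<open>Weierstrass approximation in the variable |phi|^2: a polynomial within \<open>e\<close>
  of \<open>h\<close> changes the pairing by at most \<open>e * J\<close>, where \<open>J\<close> is
  \<open>K\<close> times the L^1 norm of \<open>f\<close>. Measurability of \<open>h\<close> is a
  separate assumption because continuity is asked for only on the interval.\<close>

lemma annihilated_continuous:
  assumes f: "annihilated f" and h: "continuous_on {0..K\<^sup>2} h" "h \<in> borel_measurable borel"
  shows "torus_inner d f (\<lambda>z. \<phi> z * of_real (h ((cmod (\<phi> z))\<^sup>2))) = 0" (is "?I = 0")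
proof (rule ccontr)
  assume "?I \<noteq> 0"
  define J where "J = K * (LINT z|torus_measure d. norm (f z))"
  have J: "0 \<le> J" unfolding J_def using K_nonneg by (intro mult_nonneg_nonneg) auto
  have intf: "integrable (torus_measure d) f" using f by (simp add: annihilated_def)
  have "cmod ?I \<le> e * J" if e: "0 < e" for e
  proof -
    obtain q where q: "real_polynomial_function q" and approx: "\<And>x. x \<in> {0..K\<^sup>2} \<Longrightarrow> \<bar>h x - q x\<bar> < e"
      using Stone_Weierstrass_real_polynomial_function[OF compact_Icc h(1) e] by blast
    have cont_q: "continuous_on A q" for A
      using continuous_real_polymonial_function[OF q] continuous_at_imp_continuous_on by blast
    have q_meas: "q \<in> borel_measurable borel"
      by (intro borel_measurable_continuous_onI cont_q)
    have bounds: "\<exists>B. \<forall>x\<in>{0..K\<^sup>2}. \<bar>u x\<bar> \<le> B" if "continuous_on {0..K\<^sup>2} u" for u :: "real \<Rightarrow> real"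
      using compact_imp_bounded[OF compact_continuous_image[OF that compact_Icc]]
      by (auto simp: bounded_iff)
    obtain B\<^sub>1 B\<^sub>2 where "\<forall>x\<in>{0..K\<^sup>2}. \<bar>h x\<bar> \<le> B\<^sub>1" "\<forall>x\<in>{0..K\<^sup>2}. \<bar>q x\<bar> \<le> B\<^sub>2"
      using bounds[OF h(1)] bounds[OF cont_q] by blast
    then have int: "integrable (torus_measure d) (\<lambda>z. f z * cnj (\<phi> z * of_real (h ((cmod (\<phi> z))\<^sup>2))))"
      "integrable (torus_measure d) (\<lambda>z. f z * cnj (\<phi> z * of_real (q ((cmod (\<phi> z))\<^sup>2))))"
      using integrable_mult_\<phi>[OF intf h(2)] integrable_mult_\<phi>[OF intf q_meas] by blast+
    have "?I = ?I - torus_inner d f (\<lambda>z. \<phi> z * of_real (q ((cmod (\<phi> z))\<^sup>2)))"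
      using annihilated_polynomial[OF f q] by simp
    also have "\<dots> = (LINT z|torus_measure d. f z * cnj (\<phi> z * of_real (h ((cmod (\<phi> z))\<^sup>2)))
        - f z * cnj (\<phi> z * of_real (q ((cmod (\<phi> z))\<^sup>2))))"
      unfolding torus_inner_def using int by simp
    also have "cmod \<dots> \<le> (LINT z|torus_measure d. e * K * norm (f z))"
    proof (rule order_trans[OF integral_norm_bound], rule integral_mono)
      fix z assume z: "z \<in> space (torus_measure d)"
      let ?x = "(cmod (\<phi> z))\<^sup>2"
      have "f z * cnj (\<phi> z * of_real (h ?x)) - f z * cnj (\<phi> z * of_real (q ?x))
          = f z * cnj (\<phi> z) * of_real (h ?x - q ?x)"
        by (simp add: algebra_simps)
      then have "cmod (f z * cnj (\<phi> z * of_real (h ?x)) - f z * cnj (\<phi> z * of_real (q ?x)))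
          = (cmod (\<phi> z) * \<bar>h ?x - q ?x\<bar>) * cmod (f z)"
        by (simp only: norm_mult complex_mod_cnj norm_of_real mult_ac)
      also have "\<dots> \<le> (K * e) * cmod (f z)"
        using norm_\<phi>_le[OF z] approx[OF norm_\<phi>_square_mem[OF z]] K_nonneg
        by (intro mult_right_mono mult_mono) auto
      finally show "cmod (f z * cnj (\<phi> z * of_real (h ?x)) - f z * cnj (\<phi> z * of_real (q ?x)))
          \<le> e * K * cmod (f z)" by (simp add: mult_ac)
    qed (use int intf in auto)
    also have "\<dots> = e * J" by (simp add: J_def)
    finally show ?thesis .
  qed
  \<comment> \<open>This \<open>e\<close> is contradictory because J / (J + 1) < 1.\<close>
  from this[of "cmod ?I / (J + 1)"] have "cmod ?I \<le> cmod ?I / (J + 1) * J"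
    using J \<open>?I \<noteq> 0\<close> by simp
  then show False using J \<open>?I \<noteq> 0\<close> by (simp add: field_simps)
qed

text \<open>For \<open>r < 2\<close> the weight is unbounded near zeros of \<open>\<phi>\<close>.
  Adding 1 / (n + 1) to |phi|^2 makes it continuous on \<open>{0..K\<^sup>2}\<close>, and dominated
  convergence removes the shift. The exponent is halved because the variable is |phi|^2.\<close>

lemma annihilated_powr:
  assumes f: "annihilated f" and r: "1 \<le> r"
  shows "torus_inner d f (\<lambda>z. \<phi> z * of_real (cmod (\<phi> z) powr (r - 2))) = 0"
proof -
  let ?T = "torus_measure d"
  define h where "h n x = (x + 1 / Suc n) powr ((r - 2) / 2)" for n and x :: real
  have h_meas [measurable]: "h n \<in> borel_measurable borel" for n
    unfolding h_def[abs_def] by measurable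
  have intf: "integrable ?T f" using f by (simp add: annihilated_def)
  then have [measurable]: "f \<in> borel_measurable ?T" by simp
  have "torus_inner d f (\<lambda>z. \<phi> z * of_real (h n ((cmod (\<phi> z))\<^sup>2))) = 0" for n
  proof (rule annihilated_continuous[OF f _ h_meas])
    show "continuous_on {0..K\<^sup>2} (h n)"
      unfolding h_def[abs_def]
      by (intro continuous_intros continuous_on_powr) (auto simp: add_nonneg_eq_0_iff)
  qed
  moreover have "(\<lambda>n. torus_inner d f (\<lambda>z. \<phi> z * of_real (h n ((cmod (\<phi> z))\<^sup>2)))) \<longlonglongrightarrow>
      torus_inner d f (\<lambda>z. \<phi> z * of_real (cmod (\<phi> z) powr (r - 2)))"
    unfolding torus_inner_def
  proof (rule integral_dominated_convergence[where w = "\<lambda>z. (K\<^sup>2 + 1) powr ((r - 1) / 2) * cmod (f z)"])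
    show "AE z in ?T. (\<lambda>n. f z * cnj (\<phi> z * of_real (h n ((cmod (\<phi> z))\<^sup>2)))) \<longlonglongrightarrow>
        f z * cnj (\<phi> z * of_real (cmod (\<phi> z) powr (r - 2)))"
    proof (rule AE_I2)
      fix z
      show "(\<lambda>n. f z * cnj (\<phi> z * of_real (h n ((cmod (\<phi> z))\<^sup>2)))) \<longlonglongrightarrow>
        f z * cnj (\<phi> z * of_real (cmod (\<phi> z) powr (r - 2)))"
      proof (cases "\<phi> z = 0")
        case False
        have "(\<lambda>n. (cmod (\<phi> z))\<^sup>2 + 1 / Suc n) \<longlonglongrightarrow> (cmod (\<phi> z))\<^sup>2 + 0"
          by (intro tendsto_intros LIMSEQ_Suc[OF lim_1_over_n])
        then have "(\<lambda>n. h n ((cmod (\<phi> z))\<^sup>2)) \<longlonglongrightarrow> ((cmod (\<phi> z))\<^sup>2 + 0) powr ((r - 2) / 2)"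
          unfolding h_def using False by (intro tendsto_powr tendsto_const) auto
        also have "((cmod (\<phi> z))\<^sup>2 + 0) powr ((r - 2) / 2) = cmod (\<phi> z) powr (r - 2)"
        proof -
          have "(cmod (\<phi> z))\<^sup>2 + 0 = cmod (\<phi> z) powr 2" "2 * ((r - 2) / 2) = r - 2"
            using False by simp_all
          then show ?thesis by (simp only: powr_powr)
        qed
        finally show ?thesis by (intro tendsto_intros)
      qed simp
    qed
    show "AE z in ?T. norm (f z * cnj (\<phi> z * of_real (h n ((cmod (\<phi> z))\<^sup>2))))
        \<le> (K\<^sup>2 + 1) powr ((r - 1) / 2) * cmod (f z)" for n
    proof (rule AE_I2)
      fix z assume z: "z \<in> space ?T"
      \<comment> \<open>Since |phi| <= sqrt \<open>?y\<close>, the product of |phi| with the weight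
        is at most \<open>?y\<close> to the power (r - 1) / 2. This exponent is nonnegative, so the
        bound \<open>K\<^sup>2 + 1\<close> for \<open>?y\<close> gives a constant independent of
        \<open>n\<close>.\<close>
      let ?y = "(cmod (\<phi> z))\<^sup>2 + 1 / Suc n"
      have y: "0 < ?y" by (simp add: add_nonneg_pos)
      have y_le: "?y \<le> K\<^sup>2 + 1"
        using norm_\<phi>_square_mem[OF z] by (intro add_mono) auto
      have "cmod (\<phi> z) = sqrt ((cmod (\<phi> z))\<^sup>2)" by simp
      also have "\<dots> \<le> sqrt ?y" by (intro real_sqrt_le_mono) simp
      also have "\<dots> = ?y powr (1 / 2)" using y by (simp add: powr_half_sqrt)
      finally have "cmod (\<phi> z) * h n ((cmod (\<phi> z))\<^sup>2) \<le> ?y powr (1 / 2) * ?y powr ((r - 2) / 2)"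
        unfolding h_def by (rule mult_right_mono) simp
      also have "\<dots> = ?y powr ((r - 1) / 2)"
        unfolding powr_add[symmetric] by (simp add: field_simps)
      also have "\<dots> \<le> (K\<^sup>2 + 1) powr ((r - 1) / 2)"
        using y y_le r by (intro powr_mono2) auto
      finally have *: "cmod (\<phi> z) * h n ((cmod (\<phi> z))\<^sup>2) \<le> (K\<^sup>2 + 1) powr ((r - 1) / 2)" .
      have "0 \<le> h n ((cmod (\<phi> z))\<^sup>2)" by (simp add: h_def)
      then show "norm (f z * cnj (\<phi> z * of_real (h n ((cmod (\<phi> z))\<^sup>2))))
          \<le> (K\<^sup>2 + 1) powr ((r - 1) / 2) * cmod (f z)"
        using mult_right_mono[OF *, of "cmod (f z)"] by (simp add: norm_mult mult_ac)
    qed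
    show "integrable ?T (\<lambda>z. (K\<^sup>2 + 1) powr ((r - 1) / 2) * cmod (f z))"
      using intf by simp
  qed measurable
  ultimately show ?thesis by (simp add: LIMSEQ_const_iff)
qed

end

section \<open>Nontriviality and minimality of the norm in the Hardy space\<close>

lemma analytic_polynomial_bounded:
  assumes "g \<in> analytic_polynomials d"
  obtains B where "g \<in> borel_measurable (torus_measure d)"
    "\<And>z. z \<in> space (torus_measure d) \<Longrightarrow> cmod (g z) \<le> B"
proof -
  obtain A a where g: "g = (\<lambda>z. \<Sum>\<alpha>\<in>A. a \<alpha> * torus_monomial d \<alpha> z)"
    using assms by (auto simp: analytic_polynomials_def)
  show thesis
  proof (rule that)
    show "g \<in> borel_measurable (torus_measure d)" unfolding g by measurable
    show "cmod (g z) \<le> (\<Sum>\<alpha>\<in>A. cmod (a \<alpha>))" if "z \<in> space (torus_measure d)" for z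
      unfolding g using that by (intro sum_norm_le) (simp add: norm_mult norm_torus_monomial)
  qed
qed

context equimodular_linear_form
begin

lemma fourier_coeff_\<phi>:
  "fourier_coeff d \<phi> \<alpha> = (\<Sum>j\<in>S. if \<forall>i\<in>{1..d}. \<alpha> i = unit_index d j i then c j else 0)"
proof -
  let ?T = "torus_measure d"
  have "fourier_coeff d \<phi> \<alpha> = (LINT z|?T. (\<Sum>j\<in>S. c j * torus_monomial d (\<lambda>i. unit_index d j i - \<alpha> i) z))"
    unfolding fourier_coeff_def
  proof (intro Bochner_Integration.integral_cong refl)
    fix z assume z: "z \<in> space ?T"
    show "\<phi> z * cnj (torus_monomial d \<alpha> z) =
        (\<Sum>j\<in>S. c j * torus_monomial d (\<lambda>i. unit_index d j i - \<alpha> i) z)"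
      unfolding \<phi>_def sum_distrib_right
    proof (rule sum.cong)
      fix j assume "j \<in> S"
      then have "torus_monomial d (unit_index d j) z = z j"
        using subset by (intro torus_monomial_unit_index) auto
      then show "c j * z j * cnj (torus_monomial d \<alpha> z) =
          c j * torus_monomial d (\<lambda>i. unit_index d j i - \<alpha> i) z"
        using torus_monomial_mult_cnj[OF z, of "unit_index d j" \<alpha>] by (simp add: mult.assoc)
    qed simp
  qed
  also have "\<dots> = (\<Sum>j\<in>S. c j * (LINT z|?T. torus_monomial d (\<lambda>i. unit_index d j i - \<alpha> i) z))"
  proof -
    have "integrable ?T (torus_monomial d \<beta>)" for \<beta>
      by (rule integrable_const_bound[where B = 1]) (auto simp: norm_torus_monomial)
    then show ?thesis by (subst Bochner_Integration.integral_sum) auto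
  qed
  also have "\<dots> = (\<Sum>j\<in>S. if \<forall>i\<in>{1..d}. \<alpha> i = unit_index d j i then c j else 0)"
    by (intro sum.cong) (auto simp: integral_torus_monomial)
  finally show ?thesis .
qed

lemma \<phi>_hardy_space:
  assumes p: "1 \<le> p"
  shows "\<phi> \<in> hardy_space d p"
proof -
  have "(\<lambda>z. 0) \<in> Lp_space (torus_measure d) p"
    by (auto simp: Lp_space_def esssup_const emeasure_space_1)
  then have "\<phi> \<in> Lp_space (torus_measure d) p"
    using Lp_space_add_bounded[OF _ p measurable_\<phi> norm_\<phi>_le] by fastforce
  moreover have "fourier_coeff d \<phi> \<alpha> = 0" if \<alpha>: "\<alpha> \<in> multi_indices d - nonneg_multi_indices d" for \<alpha>
  proof -
    obtain i where "i \<in> {1..d}" "\<alpha> i < 0"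
      using \<alpha> by (auto simp: multi_indices_def nonneg_multi_indices_def PiE_iff not_le)
    moreover have "0 \<le> unit_index d j i" if "i \<in> {1..d}" for j i
      using that by (simp add: unit_index_def)
    ultimately have "\<not> (\<forall>i\<in>{1..d}. \<alpha> i = unit_index d j i)" for j
      by (metis not_le)
    then show ?thesis unfolding fourier_coeff_\<phi> by (intro sum.neutral) auto
  qed
  ultimately show ?thesis by (simp add: hardy_space_def)
qed

text \<open>The Fourier coefficient of \<open>\<phi>\<close> at the frequency of z_m is
  \<open>c m\<close>.\<close>

lemma \<phi>_not_AE_zero:
  assumes "m \<in> S" "c m \<noteq> 0"
  shows "\<not> (AE z in torus_measure d. \<phi> z = 0)"
proof
  assume "AE z in torus_measure d. \<phi> z = 0"
  then have "AE z in torus_measure d. \<phi> z * cnj (torus_monomial d (unit_index d m) z) = 0"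
    by eventually_elim simp
  then have "fourier_coeff d \<phi> (unit_index d m) = 0"
    unfolding fourier_coeff_def by (rule integral_eq_zero_AE)
  moreover have "(\<forall>i\<in>{1..d}. unit_index d m i = unit_index d j i) \<longleftrightarrow> j = m" if "j \<in> S" for j
    using that assms(1) subset by (auto simp: unit_index_def)
  then have "fourier_coeff d \<phi> (unit_index d m) = (\<Sum>j\<in>S. if j = m then c j else 0)"
    unfolding fourier_coeff_\<phi> by (intro sum.cong) auto
  moreover have "finite S" using subset finite_subset by blast
  ultimately show False using assms by simp
qed

text \<open>This unifies the two meanings of orthogonality. For \<open>p < 2\<close>, pairing with
  the bounded \<open>\<phi>\<close> is continuous in L^1 and hence, on a probability space, in L^p.
  It therefore vanishes on the closure of the polynomials that it annihilates.\<close>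

lemma annihilated_if_hardy_orthogonal:
  assumes f: "f \<in> hardy_space d p" and p: "1 \<le> p" and orth: "hardy_orthogonal d p f \<phi>"
  shows "annihilated f"
proof -
  let ?T = "torus_measure d"
  have f_Lp: "f \<in> Lp_space ?T p" using f by (simp add: hardy_space_def)
  then have intf: "integrable ?T f" using p by (rule integrable_Lp_space)
  have "torus_inner d f \<phi> = 0"
  proof (cases "p < 2")
    case False
    then show ?thesis using orth by (simp add: hardy_orthogonal_def)
  next
    case True
    then have p_fin: "p \<noteq> \<infinity>" by auto
    define r where "r = enn2real p"
    have r: "1 \<le> r" using enn2real_ge_1[OF p p_fin] by (simp add: r_def)
    have "cmod (torus_inner d f \<phi>) \<le> K * \<epsilon>" if "0 < \<epsilon>" for \<epsilon>
    proof -
      obtain g where g: "g \<in> analytic_polynomials d" and g_orth: "torus_inner d g \<phi> = 0"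
        and close: "hardy_norm d p (\<lambda>z. f z - g z) < \<epsilon>"
        using orth \<open>0 < \<epsilon>\<close> True by (auto simp: hardy_orthogonal_def)
      obtain B where g_meas: "g \<in> borel_measurable ?T" and B: "\<And>z. z \<in> space ?T \<Longrightarrow> cmod (g z) \<le> B"
        using analytic_polynomial_bounded[OF g] by blast
      have intg: "integrable ?T g"
        using g_meas B by (intro integrable_const_bound[where B = B]) auto
      have "(\<lambda>z. f z + - g z) \<in> Lp_space ?T p"
        using g_meas B by (intro Lp_space_add_bounded[OF f_Lp p]) auto
      then have int_r: "integrable ?T (\<lambda>z. cmod (f z - g z) powr r)"
        using p_fin by (simp add: Lp_space_def r_def)
      have mult_\<phi>: "integrable ?T (\<lambda>z. u z * cnj (\<phi> z))" if "integrable ?T u" for u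
      proof (rule integrable_mult_bounded[OF that])
        show "(\<lambda>z. cnj (\<phi> z)) \<in> borel_measurable ?T" by measurable
        show "cmod (cnj (\<phi> z)) \<le> K" if "z \<in> space ?T" for z
          using norm_\<phi>_le[OF that] by simp
      qed
      have "torus_inner d f \<phi> = torus_inner d f \<phi> - torus_inner d g \<phi>" using g_orth by simp
      also have "\<dots> = (LINT z|?T. f z * cnj (\<phi> z) - g z * cnj (\<phi> z))"
        unfolding torus_inner_def using mult_\<phi>[OF intf] mult_\<phi>[OF intg] by simp
      also have "cmod \<dots> \<le> (LINT z|?T. K * cmod (f z - g z))"
      proof (rule order_trans[OF integral_norm_bound], rule integral_mono)
        fix z assume "z \<in> space ?T"
        then have "cmod (f z - g z) * cmod (\<phi> z) \<le> cmod (f z - g z) * K"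
          by (intro mult_left_mono norm_\<phi>_le) auto
        then show "cmod (f z * cnj (\<phi> z) - g z * cnj (\<phi> z)) \<le> K * cmod (f z - g z)"
          by (simp add: norm_mult mult.commute flip: left_diff_distrib)
      qed (use mult_\<phi>[OF intf] mult_\<phi>[OF intg] intf intg in auto)
      also have "\<dots> = K * (LINT z|?T. cmod (f z - g z))" by simp
      also have "\<dots> \<le> K * (LINT z|?T. cmod (f z - g z) powr r) powr (1 / r)"
        using intf intg int_r r by (intro mult_left_mono integral_le_integral_powr K_nonneg) auto
      also have "\<dots> = K * hardy_norm d p (\<lambda>z. f z - g z)"
        using p_fin by (simp add: Lp_norm_def r_def)
      also have "\<dots> \<le> K * \<epsilon>" using close K_nonneg by (intro mult_left_mono) auto
      finally show ?thesis .
    qed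
    \<comment> \<open>As K / (K + 1) < 1, this choice of the tolerance rules out a nonzero pairing;
      the 1 covers \<open>K = 0\<close>.\<close>
    from this[of "cmod (torus_inner d f \<phi>) / (K + 1)"] show ?thesis
      using K_nonneg by (cases "torus_inner d f \<phi> = 0") (auto simp: field_simps)
  qed
  then show ?thesis using f intf by (simp add: annihilated_def hardy_space_def)
qed

text \<open>The supporting hyperplane inequality at \<open>\<phi> z\<close> in direction
  \<open>f z\<close> is integrated; its linear term is r times the real part of the pairing of
  \<open>f\<close> with \<open>\<psi>\<close>, which is zero.\<close>

lemma norm_le_if_annihilated_finite:
  assumes f: "annihilated f" "f \<in> Lp_space (torus_measure d) p" and p: "1 \<le> p" "p \<noteq> \<infinity>"
  shows "hardy_norm d p \<phi> \<le> hardy_norm d p (\<lambda>z. \<phi> z + f z)"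
proof -
  let ?T = "torus_measure d"
  define r where "r = enn2real p"
  have r: "1 \<le> r" using enn2real_ge_1[OF p] by (simp add: r_def)
  define \<psi> where "\<psi> z = \<phi> z * of_real (cmod (\<phi> z) powr (r - 2))" for z
  have intf: "integrable ?T f" using f by (simp add: annihilated_def)
  have int_sum: "integrable ?T (\<lambda>z. cmod (\<phi> z + f z) powr r)"
    using Lp_space_add_bounded[OF f(2) p(1) measurable_\<phi> norm_\<phi>_le] p(2)
    by (simp add: Lp_space_def r_def add.commute)
  have int_\<phi>: "integrable ?T (\<lambda>z. cmod (\<phi> z) powr r)"
    using \<phi>_hardy_space[OF p(1)] p(2) by (simp add: hardy_space_def Lp_space_def r_def)
  have int_\<psi>: "integrable ?T (\<lambda>z. f z * cnj (\<psi> z))"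
  proof (rule integrable_mult_bounded[OF intf])
    show "(\<lambda>z. cnj (\<psi> z)) \<in> borel_measurable ?T" unfolding \<psi>_def by measurable
    \<comment> \<open>Although the weight may be singular, the modulus of \<open>\<psi>\<close> is
      |phi|^(r-1) off the zeros of \<open>\<phi>\<close> and 0 on them.\<close>
    show "cmod (cnj (\<psi> z)) \<le> K powr (r - 1)" if "z \<in> space ?T" for z
    proof (cases "\<phi> z = 0")
      case False
      then have "cmod (cnj (\<psi> z)) = cmod (\<phi> z) powr (r - 1)"
        using powr_add[of "cmod (\<phi> z)" "r - 2" 1] by (simp add: \<psi>_def norm_mult)
      then show ?thesis using norm_\<phi>_le[OF that] r by (simp add: powr_mono2)
    qed (simp add: \<psi>_def)
  qed
  define R where "R z = Re (f z * cnj (\<psi> z))" for z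
  have int_R: "integrable ?T R"
    unfolding R_def[abs_def] by (rule integrable_Re[OF int_\<psi>])
  have "torus_inner d f \<psi> = 0"
    unfolding \<psi>_def[abs_def] using f(1) r by (rule annihilated_powr)
  moreover have "(LINT z|?T. R z) = Re (torus_inner d f \<psi>)"
    unfolding torus_inner_def R_def by (rule integral_Re[OF int_\<psi>])
  ultimately have "(LINT z|?T. cmod (\<phi> z) powr r) = (LINT z|?T. cmod (\<phi> z) powr r + r * R z)"
    using int_\<phi> int_R by simp
  also have "\<dots> \<le> (LINT z|?T. cmod (\<phi> z + f z) powr r)"
  proof (rule integral_mono)
    show "integrable ?T (\<lambda>z. cmod (\<phi> z) powr r + r * R z)"
      by (intro Bochner_Integration.integrable_add int_\<phi> integrable_mult_right int_R)
    show "cmod (\<phi> z) powr r + r * R z \<le> cmod (\<phi> z + f z) powr r" for z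
      unfolding R_def \<psi>_def using r by (rule norm_powr_above_tangent)
  qed (rule int_sum)
  finally show ?thesis
    using p r unfolding Lp_norm_def r_def[symmetric] by (auto intro!: powr_mono2)
qed

text \<open>Testing against \<open>\<phi> (\<bar>\<phi>\<bar> - M)\<^sub>+\<^sup>2\<close>, where \<open>M\<close> is the norm of \<open>\<phi> + f\<close>, forces
  \<open>\<bar>\<phi>\<bar> \<le> M\<close> almost everywhere.\<close>

lemma norm_le_if_annihilated_top:
  assumes f: "annihilated f" "f \<in> Lp_space (torus_measure d) \<infinity>"
  shows "hardy_norm d \<infinity> \<phi> \<le> hardy_norm d \<infinity> (\<lambda>z. \<phi> z + f z)"
proof -
  let ?T = "torus_measure d"
  define M where "M = hardy_norm d \<infinity> (\<lambda>z. \<phi> z + f z)"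
  have M: "0 \<le> M" by (simp add: M_def Lp_norm_def)
  \<comment> \<open>Finiteness of the essential supremum is secured first: \<open>enn2real\<close>
    sends infinity to 0, and \<open>M\<close> would then bound nothing.\<close>
  have "(\<lambda>z. f z + \<phi> z) \<in> Lp_space ?T \<infinity>"
    using Lp_space_add_bounded[OF f(2) _ measurable_\<phi> norm_\<phi>_le] by simp
  then have "esssup ?T (\<lambda>z. ennreal (cmod (\<phi> z + f z))) < \<infinity>"
    by (simp add: Lp_space_def add.commute)
  then have bound: "AE z in ?T. cmod (\<phi> z + f z) \<le> M"
    unfolding M_def Lp_norm_def using AE_norm_le_esssup by fastforce
  define h where "h x = (max 0 (sqrt x - M))\<^sup>2" for x
  have h_cont: "continuous_on A h" for A
    unfolding h_def[abs_def] by (intro continuous_intros)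
  then have h_meas [measurable]: "h \<in> borel_measurable borel"
    by (intro borel_measurable_continuous_onI)
  \<comment> \<open>From |phi + f| <= M follows |phi| (|phi| - M) <= - Re (f cnj(phi)). Multiplying
    by the weight turns the left side into \<open>G\<close> and the right side into
    \<open>- R\<close>, whose integral is zero.\<close>
  define G where "G z = cmod (\<phi> z) * (max 0 (cmod (\<phi> z) - M)) ^ 3" for z
  define \<psi> where "\<psi> z = \<phi> z * of_real (h ((cmod (\<phi> z))\<^sup>2))" for z
  have orth: "torus_inner d f \<psi> = 0"
    unfolding \<psi>_def[abs_def] by (intro annihilated_continuous f h_cont h_meas)
  have int_\<psi>: "integrable ?T (\<lambda>z. f z * cnj (\<psi> z))"
  proof -
    have "\<bar>h x\<bar> \<le> K\<^sup>2" if "x \<in> {0..K\<^sup>2}" for x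
    proof -
      have "sqrt x \<le> K" using that K_nonneg by (intro real_le_lsqrt) auto
      then show ?thesis unfolding h_def using M K_nonneg by (auto intro!: power_mono)
    qed
    then show ?thesis
      unfolding \<psi>_def using f by (intro integrable_mult_\<phi> h_meas) (auto simp: annihilated_def)
  qed
  define R where "R z = Re (f z * cnj (\<psi> z))" for z
  have int_R: "integrable ?T R"
    unfolding R_def[abs_def] by (rule integrable_Re[OF int_\<psi>])
  have "(LINT z|?T. R z) = Re (torus_inner d f \<psi>)"
    unfolding torus_inner_def R_def by (rule integral_Re[OF int_\<psi>])
  then have zero: "(LINT z|?T. R z) = 0" using orth by simp
  have G_nonneg: "0 \<le> G z" for z by (simp add: G_def)
  have int_G: "integrable ?T G"
  proof (rule integrable_const_bound)
    show "AE z in ?T. norm (G z) \<le> K * K ^ 3"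
    proof (rule AE_I2)
      fix z assume "z \<in> space ?T"
      then have "cmod (\<phi> z) \<le> K" by (rule norm_\<phi>_le)
      then show "norm (G z) \<le> K * K ^ 3"
        using M K_nonneg G_nonneg[of z] unfolding G_def
        by (auto intro!: mult_mono power_mono)
    qed
    show "G \<in> borel_measurable ?T" unfolding G_def[abs_def] by measurable
  qed
  have "AE z in ?T. G z \<le> - R z"
    using bound
  proof eventually_elim
    case (elim z)
    define s where "s = cmod (\<phi> z)"
    define u where "u = (max 0 (s - M))\<^sup>2"
    have u: "0 \<le> u" by (simp add: u_def)
    have "Re ((\<phi> z + f z) * cnj (\<phi> z)) \<le> cmod (\<phi> z + f z) * s"
      using complex_Re_le_cmod[of "(\<phi> z + f z) * cnj (\<phi> z)"] by (simp add: norm_mult s_def)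
    also have "\<dots> \<le> M * s" using elim by (intro mult_right_mono) (auto simp: s_def)
    finally have "Re (\<phi> z * cnj (\<phi> z)) + Re (f z * cnj (\<phi> z)) \<le> M * s"
      by (simp add: algebra_simps)
    moreover have "Re (\<phi> z * cnj (\<phi> z)) = s * s"
      unfolding s_def by (metis Re_complex_of_real complex_norm_square of_real_power power2_eq_square)
    ultimately have "s * (s - M) \<le> - Re (f z * cnj (\<phi> z))"
      by (simp add: algebra_simps)
    then have "u * (s * (s - M)) \<le> u * - Re (f z * cnj (\<phi> z))"
      using u by (rule mult_left_mono)
    moreover have "G z = u * (s * (s - M))"
      by (auto simp: G_def u_def s_def max_def power2_eq_square power3_eq_cube)
    moreover have "R z = u * Re (f z * cnj (\<phi> z))"
      by (simp add: R_def \<psi>_def h_def u_def s_def algebra_simps)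
    ultimately show ?case by linarith
  qed
  then have "(LINT z|?T. G z) \<le> (LINT z|?T. - R z)"
    using int_G int_R by (intro integral_mono_AE) auto
  then have "(LINT z|?T. G z) = 0"
    using zero G_nonneg by (simp add: antisym)
  then have "AE z in ?T. G z = 0"
    using integral_nonneg_eq_0_iff_AE[OF int_G] G_nonneg by simp
  \<comment> \<open>Where \<open>G\<close> vanishes, either |phi| <= M or \<open>\<phi>\<close> is
    zero, and the latter is covered by \<open>0 \<le> M\<close>.\<close>
  then have "AE z in ?T. cmod (\<phi> z) \<le> M"
  proof eventually_elim
    case (elim z)
    then show ?case using M by (auto simp: G_def max_def split: if_splits)
  qed
  then show ?thesis unfolding M_def[symmetric] using M by (intro Lp_norm_top_le) auto
qed

lemma hilbert_point_\<phi>: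
  assumes "m \<in> S" "c m \<noteq> 0" "1 \<le> p"
  shows "hilbert_point d p \<phi>"
  unfolding hilbert_point_def
proof (intro conjI ballI impI)
  fix f assume "f \<in> hardy_space d p" "hardy_orthogonal d p f \<phi>"
  then have "annihilated f" "f \<in> Lp_space (torus_measure d) p"
    using assms(3) by (auto intro: annihilated_if_hardy_orthogonal simp: hardy_space_def)
  then show "hardy_norm d p \<phi> \<le> hardy_norm d p (\<lambda>z. \<phi> z + f z)"
    using norm_le_if_annihilated_finite norm_le_if_annihilated_top assms(3) by (cases "p = \<infinity>") auto
qed (use \<phi>_hardy_space[OF assms(3)] \<phi>_not_AE_zero[OF assms(1,2)] in \<open>simp_all only: simp_thms\<close>)

end

theorem theorem1p3:
  fixes d :: nat and c :: "nat \<Rightarrow> complex"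
  assumes "d \<ge> 1"
    and "\<exists>j\<in>{1..d}. c j \<noteq> 0"
    and "\<forall>i\<in>{1..d}. \<forall>j\<in>{1..d}. c i \<noteq> 0 \<longrightarrow> c j \<noteq> 0 \<longrightarrow> cmod (c i) = cmod (c j)"
  shows "\<forall>p::ennreal. 1 \<le> p \<longrightarrow> hilbert_point d p (\<lambda>z. \<Sum>j=1..d. c j * z j)"
proof (intro allI impI)
  fix p :: ennreal assume p: "1 \<le> p"
  obtain m where m: "m \<in> {1..d}" "c m \<noteq> 0" using assms(2) by blast
  \<comment> \<open>Words are formed only from indices with nonzero coefficient, so that all letters
    carry the same modulus.\<close>
  define S where "S = {j\<in>{1..d}. c j \<noteq> 0}"
  interpret equimodular_linear_form d c S "cmod (c m)"
  proof
    show "S \<subseteq> {1..d}" by (auto simp: S_def)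
    show "cmod (c j) = cmod (c m)" if "j \<in> S" for j
      using that m assms(3) unfolding S_def by blast
  qed
  have "(\<Sum>j\<in>S. c j * z j) = (\<Sum>j=1..d. c j * z j)" for z :: "nat \<Rightarrow> complex"
    by (intro sum.mono_neutral_left) (auto simp: S_def)
  then have "\<phi> = (\<lambda>z. \<Sum>j=1..d. c j * z j)"
    by (simp only: \<phi>_def[abs_def])
  moreover have "m \<in> S" using m by (simp add: S_def)
  then have "hilbert_point d p \<phi>" using m(2) p by (rule hilbert_point_\<phi>)
  ultimately show "hilbert_point d p (\<lambda>z. \<Sum>j=1..d. c j * z j)" by (simp only:)
qed

end
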